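(* Let $A\in\mathbb{R}^{m\times n}$, $b\in\mathbb{R}^m$, $\lambda>0$, and let $\bar x\in\mathbb{R}^n$ be a solution of $\min_{x\in\mathbb{R}^n}\|Ax-b\|+\lambda\|x\|_1$. Suppose that $A\bar x\neq b$ and that, with $\bar y:=\frac{b-A\bar x}{\|A\bar x-b\|}$ and $J:=\{i\in\{1,\dots,n\}:|A_i^{\top}\bar y|=\lambda\}$, one has $\ker A_J=\{0\}$ and $b\notin\operatorname{rge}A_J$. Then $\bar x$ is the unique solution of $\min_{x\in\mathbb{R}^n}\|Ax-b\|+\lambda\|x\|_1$ and $$\bar x=L_J\left(BA_J^{\top}(\mathbb{I}-\bar y\bar y^{\top})b\right),\qquad B:=\left[A_J^{\top}(\mathbb{I}-\bar y\bar y^{\top})A_J\right]^{-1}.$$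
   Context: $\|\cdot\|$ is the Euclidean norm, $\|x\|_1=\sum_i|x_i|$, $\mathbb{I}$ the identity matrix. For $K\subseteq\{1,\dots,n\}$, $A_K$ is the $m\times|K|$ matrix formed by the columns $A_i$ of $A$ with $i\in K$; $\operatorname{rge}$ denotes the range. For $w\in\mathbb{R}^{|K|}$ indexed by $K$, $L_K(w)\in\mathbb{R}^n$ is its extension by zero: $(L_K(w))_i=w_i$ for $i\in K$ and $0$ otherwise. The invertibility of $A_J^{\top}(\mathbb{I}-\bar y\bar y^{\top})A_J$ is part of the assertion. *)

theory Defs
  imports
    Complex_Main
    "Jordan_Normal_Form.Matrix"
    "Jordan_Normal_Form.Matrix_Kernel"
    "Jordan_Normal_Form.DL_Submatrix"
begin

text \<open>
  Vectors and matrices are those of \<^theory>\<open>Jordan_Normal_Form.Matrix\<close>, whose dimensions are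
  values, since the number of columns of \<open>A\<^sub>K\<close> depends on the set \<open>K\<close>.
  All indices start at \<open>0\<close>, so index sets are subsets of \<open>{0..<n}\<close>.
\<close>

definition norm2_vec :: "real vec \<Rightarrow> real" where
  "norm2_vec v = sqrt (\<Sum>i<dim_vec v. (v $ i)\<^sup>2)"

definition norm1_vec :: "real vec \<Rightarrow> real" where
  "norm1_vec v = (\<Sum>i<dim_vec v. \<bar>v $ i\<bar>)"

definition sqrt_lasso_obj :: "real mat \<Rightarrow> real vec \<Rightarrow> real \<Rightarrow> real vec \<Rightarrow> real" where
  "sqrt_lasso_obj A b lam x = norm2_vec (A *\<^sub>v x - b) + lam * norm1_vec x"

definition is_sqrt_lasso_solution :: "real mat \<Rightarrow> real vec \<Rightarrow> real \<Rightarrow> real vec \<Rightarrow> bool" where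
  "is_sqrt_lasso_solution A b lam x \<longleftrightarrow>
     is_arg_min (sqrt_lasso_obj A b lam) (\<lambda>z. z \<in> carrier_vec (dim_col A)) x"

text \<open>\<open>A\<^sub>K\<close>: all rows of \<open>A\<close>, and the columns with index in \<open>K\<close>, in increasing order.\<close>

definition cols_submat :: "'a mat \<Rightarrow> nat set \<Rightarrow> 'a mat" where
  "cols_submat A K = submatrix A UNIV K"

definition mat_range :: "'a::semiring_0 mat \<Rightarrow> 'a vec set" where
  "mat_range A = {A *\<^sub>v w | w. w \<in> carrier_vec (dim_col A)}"

text \<open>
  \<open>L\<^sub>K\<close>: a vector indexed by \<open>K\<close> is a vector of dimension \<open>card K\<close> whose entries are listed in
  increasing order of the elements of \<open>K\<close>, as for the columns of \<open>A\<^sub>K\<close>. The entry belonging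
  to \<open>i \<in> K\<close> therefore has position \<open>card {k \<in> K. k < i}\<close>.
\<close>

definition zero_extend :: "nat \<Rightarrow> nat set \<Rightarrow> 'a::zero vec \<Rightarrow> 'a vec" where
  "zero_extend n K w = vec n (\<lambda>i. if i \<in> K then w $ card {k \<in> K. k < i} else 0)"

text \<open>The column vector \<open>v\<close> times the row vector \<open>v\<^sup>T\<close>.\<close>

definition outer_square :: "'a::semiring_0 vec \<Rightarrow> 'a mat" where
  "outer_square v = transpose_mat (mat_of_row v) * mat_of_row v"

end

theory Submission
  imports Defs "Jordan_Normal_Form.Determinant"
begin

text \<open>
  Perturbing a solution one coordinate at a time gives the optimality conditions
  \<open>\<bar>A\<^sub>i\<^sup>T y\<bar> \<le> \<lambda>\<close> and \<open>(A\<^sub>i\<^sup>T y) x\<^sub>i = \<lambda> \<bar>x\<^sub>i\<bar>\<close>. Hence \<open>y\<close> is a dual certificate: the objective at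
  \<open>z\<close> exceeds \<open>y\<^sup>T b\<close> by the sum of the nonnegative terms \<open>\<parallel>b - A z\<parallel> - y\<^sup>T (b - A z)\<close> and
  \<open>\<lambda> \<bar>z\<^sub>i\<bar> - (A\<^sub>i\<^sup>T y) z\<^sub>i\<close>, so that all of them vanish when \<open>z\<close> is a solution. Thus every solution is
  supported in \<open>J\<close> and has its residual on the line through \<open>y\<close>, which the projection
  \<open>P = I - y y\<^sup>T\<close> kills; this reads \<open>M z\<^sub>J = A\<^sub>J\<^sup>T P b\<close>. Finally \<open>M w = 0\<close> forces \<open>P A\<^sub>J w = 0\<close>, so
  \<open>A\<^sub>J w\<close> is a multiple of \<open>y\<close>, and a nonzero multiple would put \<open>b\<close> into the range of \<open>A\<^sub>J\<close>.
\<close>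

section \<open>Euclidean norm and inner product\<close>

lemma norm2_vec_nonneg: "0 \<le> norm2_vec v"
  by (simp add: norm2_vec_def sum_nonneg)

lemma norm2_vec_power2: "(norm2_vec v)\<^sup>2 = v \<bullet> v"
  by (simp add: norm2_vec_def scalar_prod_def sum_nonneg power2_eq_square atLeast0LessThan)

lemma norm2_vec_minus_commute:
  assumes "v \<in> carrier_vec m" "w \<in> carrier_vec m"
  shows "norm2_vec (v - w) = norm2_vec (w - v)"
  using assms by (simp add: norm2_vec_def power2_commute)

lemma scalar_prod_self_eq_0_iff:
  fixes v :: "real vec"
  assumes "v \<in> carrier_vec m"
  shows "v \<bullet> v = 0 \<longleftrightarrow> v = 0\<^sub>v m"
  using conjugate_square_eq_0_vec[OF assms] by simp

lemma scalar_prod_self_nonneg: "0 \<le> v \<bullet> (v :: real vec)"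
  by (simp add: scalar_prod_def sum_nonneg)

lemma minus_vec_eq_zeroD:
  fixes v w :: "'a :: group_add vec"
  assumes "v \<in> carrier_vec m" "w \<in> carrier_vec m" "v - w = 0\<^sub>v m"
  shows "v = w"
proof (intro eq_vecI)
  fix i assume "i < dim_vec w"
  moreover have "(v - w) $ i = 0\<^sub>v m $ i" using assms(3) by simp
  ultimately show "v $ i = w $ i" using assms(1,2) by simp
qed (use assms in simp)

lemma scalar_prod_diff_smult_self:
  fixes r a :: "real vec"
  assumes "r \<in> carrier_vec m" "a \<in> carrier_vec m"
  shows "(r - t \<cdot>\<^sub>v a) \<bullet> (r - t \<cdot>\<^sub>v a) = r \<bullet> r - 2 * t * (a \<bullet> r) + t\<^sup>2 * (a \<bullet> a)"
proof -
  have "a \<bullet> r = r \<bullet> a" using assms by (rule comm_scalar_prod[rotated])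
  with assms show ?thesis
    by (simp add: minus_scalar_prod_distrib[of _ m] scalar_prod_minus_distrib[of _ m]
        power2_eq_square algebra_simps)
qed

section \<open>First-order optimality by coordinate perturbation\<close>

text \<open>Dividing the expansion of a nonnegative square by twice \<open>norm2_vec r\<close>
  bounds the norm by a quadratic in \<open>t\<close> that has the exact slope at
  \<open>t = 0\<close>. This takes the place of differentiating the norm.\<close>

lemma norm2_vec_diff_smult_le:
  assumes "r \<in> carrier_vec m" "a \<in> carrier_vec m" and pos: "norm2_vec r > 0"
  shows "norm2_vec (r - t \<cdot>\<^sub>v a)
    \<le> norm2_vec r - t * (a \<bullet> r / norm2_vec r) + t\<^sup>2 * (a \<bullet> a / (2 * norm2_vec r))"
proof -
  let ?R = "norm2_vec r" and ?N = "norm2_vec (r - t \<cdot>\<^sub>v a)"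
  have "0 \<le> (?N - ?R)\<^sup>2" by simp
  then have "2 * ?R * ?N \<le> ?N\<^sup>2 + ?R\<^sup>2" by (simp add: power2_eq_square algebra_simps)
  also have "\<dots> = 2 * ?R\<^sup>2 - 2 * t * (a \<bullet> r) + t\<^sup>2 * (a \<bullet> a)"
    using assms by (simp add: norm2_vec_power2 scalar_prod_diff_smult_self)
  also have "\<dots> = 2 * ?R * (?R - t * (a \<bullet> r / ?R) + t\<^sup>2 * (a \<bullet> a / (2 * ?R)))"
    using pos by (simp add: field_simps power2_eq_square)
  finally show ?thesis using pos by simp
qed

text \<open>Small steps make the quadratic term negligible. Together the two conclusions say that
  \<open>c\<close> is a subgradient of \<open>lam * |.|\<close> at \<open>x\<close>.\<close>

lemma smult_le_power2_imp_abs_subgradient: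
  fixes c k lam x :: real
  assumes le: "\<And>t. t * c \<le> t\<^sup>2 * k + lam * (\<bar>x + t\<bar> - \<bar>x\<bar>)" and lam: "lam > 0"
  shows "\<bar>c\<bar> \<le> lam" and "c * x = lam * \<bar>x\<bar>"
proof -
  \<comment> \<open>This replaces division by \<open>s\<close> followed by the limit
    \<open>s\<close> to 0.\<close>
  have small: "p \<le> q" if "\<And>s. 0 < s \<Longrightarrow> s \<le> 1 \<Longrightarrow> s * p \<le> s\<^sup>2 * e + s * q" for p q e :: real
  proof (rule ccontr)
    assume "\<not> p \<le> q"
    \<comment> \<open>The second bound makes \<open>s * e\<close> at most half the gap
      \<open>p - q\<close>; adding 1 keeps the denominator positive when
      \<open>e = 0\<close>.\<close>
    define s where "s = min 1 ((p - q) / (2 * (\<bar>e\<bar> + 1)))"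
    have s: "0 < s" "s \<le> 1" using \<open>\<not> p \<le> q\<close> by (auto simp: s_def)
    from that[OF s] have "s * p \<le> s * (s * e + q)" by (simp add: power2_eq_square algebra_simps)
    then have "p - q \<le> s * e" using s by simp
    also have "\<dots> \<le> s * (\<bar>e\<bar> + 1)" using s by (intro mult_left_mono) auto
    also have "\<dots> \<le> (p - q) / (2 * (\<bar>e\<bar> + 1)) * (\<bar>e\<bar> + 1)"
      by (intro mult_right_mono) (auto simp: s_def)
    also have "\<dots> = (p - q) / 2" by (simp add: field_simps)
    finally show False using \<open>\<not> p \<le> q\<close> by simp
  qed
  \<comment> \<open>The triangle inequality eliminates \<open>x\<close>; positive and negative
    \<open>t\<close> then bound \<open>c\<close> from both sides.\<close>
  have *: "t * c \<le> t\<^sup>2 * k + lam * \<bar>t\<bar>" for t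
  proof -
    have "lam * (\<bar>x + t\<bar> - \<bar>x\<bar>) \<le> lam * \<bar>t\<bar>"
      using lam by (intro mult_left_mono) auto
    with le[of t] show ?thesis by linarith
  qed
  have "c \<le> lam" using *  by (intro small[of c k lam]) (metis abs_of_pos mult.commute)
  moreover have "- c \<le> lam"
  proof (rule small[of "- c" k lam])
    fix s :: real assume "0 < s"
    with *[of "- s"] show "s * - c \<le> s\<^sup>2 * k + s * lam" by (simp add: mult.commute)
  qed
  ultimately show abs_c: "\<bar>c\<bar> \<le> lam" by simp
  \<comment> \<open>The perturbation \<open>- (s * x)\<close> shrinks \<open>x\<close> towards 0,
    where the absolute value is linear in \<open>s\<close> up to \<open>s = 1\<close>.\<close>
  have "lam * \<bar>x\<bar> \<le> c * x"
  proof (rule small[of _ "x\<^sup>2 * k"])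
    fix s :: real assume s: "0 < s" "s \<le> 1"
    have "\<bar>x + - (s * x)\<bar> = \<bar>(1 - s) * x\<bar>" by (simp add: algebra_simps)
    also have "\<dots> = (1 - s) * \<bar>x\<bar>" using s by (simp add: abs_mult)
    finally have diff: "\<bar>x + - (s * x)\<bar> - \<bar>x\<bar> = - (s * \<bar>x\<bar>)" by (simp add: algebra_simps)
    from le[of "- (s * x)"] show "s * (lam * \<bar>x\<bar>) \<le> s\<^sup>2 * (x\<^sup>2 * k) + s * (c * x)"
      unfolding diff by (simp add: power_mult_distrib mult_ac)
  qed
  moreover have "c * x \<le> \<bar>c\<bar> * \<bar>x\<bar>" by (metis abs_ge_self abs_mult)
  moreover have "\<bar>c\<bar> * \<bar>x\<bar> \<le> lam * \<bar>x\<bar>" using abs_c by (simp add: mult_right_mono)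
  ultimately show "c * x = lam * \<bar>x\<bar>" by linarith
qed

lemma mult_mat_vec_add_unit_vec:
  fixes A :: "real mat"
  assumes A: "A \<in> carrier_mat m n" and x: "x \<in> carrier_vec n" and i: "i < n"
  shows "A *\<^sub>v (x + t \<cdot>\<^sub>v unit_vec n i) = A *\<^sub>v x + t \<cdot>\<^sub>v col A i"
proof -
  have "A *\<^sub>v unit_vec n i = col A i" using A i by (intro eq_vecI) auto
  then show ?thesis
    using assms by (simp add: mult_add_distrib_mat_vec[OF A x] mult_mat_vec[OF A])
qed

lemma norm1_vec_add_unit_vec:
  assumes x: "x \<in> carrier_vec n" and i: "i < n"
  shows "norm1_vec (x + t \<cdot>\<^sub>v unit_vec n i) = norm1_vec x + (\<bar>x $ i + t\<bar> - \<bar>x $ i\<bar>)"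
proof -
  have "norm1_vec (x + t \<cdot>\<^sub>v unit_vec n i) = (\<Sum>j<n. \<bar>x $ j + (if j = i then t else 0)\<bar>)"
    using assms by (auto simp: norm1_vec_def intro!: sum.cong)
  also have "\<dots> = (\<Sum>j<n. \<bar>x $ j\<bar> + (if j = i then \<bar>x $ i + t\<bar> - \<bar>x $ i\<bar> else 0))"
    by (intro sum.cong) auto
  also have "\<dots> = norm1_vec x + (\<bar>x $ i + t\<bar> - \<bar>x $ i\<bar>)"
    using assms by (simp add: sum.distrib norm1_vec_def)
  finally show ?thesis .
qed

lemma sqrt_lasso_obj_eq:
  assumes "A \<in> carrier_mat m n" "b \<in> carrier_vec m" "x \<in> carrier_vec n"
  shows "sqrt_lasso_obj A b lam x = norm2_vec (b - A *\<^sub>v x) + lam * norm1_vec x"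
  unfolding sqrt_lasso_obj_def
  using norm2_vec_minus_commute[of "A *\<^sub>v x" m b] assms by auto

lemma sqrt_lasso_solutionD:
  assumes "is_sqrt_lasso_solution A b lam x" "A \<in> carrier_mat m n"
  shows "x \<in> carrier_vec n"
    and "z \<in> carrier_vec n \<Longrightarrow> sqrt_lasso_obj A b lam x \<le> sqrt_lasso_obj A b lam z"
  using assms unfolding is_sqrt_lasso_solution_def is_arg_min_linorder by auto

text \<open>A move along the \<open>i\<close>-th unit vector shifts the residual by a multiple of
  \<open>col A i\<close> and alters one term of the 1-norm. Minimality and the quadratic bound on
  the norm then yield the scalar inequality with \<open>c = col A i \<bullet> y\<close>.\<close>

lemma sqrt_lasso_optimality:
  assumes A: "A \<in> carrier_mat m n" and b: "b \<in> carrier_vec m" and lam: "lam > 0"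
    and sol: "is_sqrt_lasso_solution A b lam x"
    and pos: "norm2_vec (b - A *\<^sub>v x) > 0"
    and y: "y = (1 / norm2_vec (b - A *\<^sub>v x)) \<cdot>\<^sub>v (b - A *\<^sub>v x)"
    and i: "i < n"
  shows "\<bar>col A i \<bullet> y\<bar> \<le> lam" and "(col A i \<bullet> y) * x $ i = lam * \<bar>x $ i\<bar>"
proof -
  define r where "r = b - A *\<^sub>v x"
  note x = sqrt_lasso_solutionD(1)[OF sol A]
  have r: "r \<in> carrier_vec m" and a: "col A i \<in> carrier_vec m"
    using A b x i by (auto simp: r_def)
  have c: "col A i \<bullet> y = col A i \<bullet> r / norm2_vec r"
    using r a unfolding y r_def[symmetric] by simp
  have le: "t * (col A i \<bullet> y)
      \<le> t\<^sup>2 * (col A i \<bullet> col A i / (2 * norm2_vec r)) + lam * (\<bar>x $ i + t\<bar> - \<bar>x $ i\<bar>)" for t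
  proof -
    let ?z = "x + t \<cdot>\<^sub>v unit_vec n i"
    have z: "?z \<in> carrier_vec n" using x by simp
    have "b - A *\<^sub>v ?z = r - t \<cdot>\<^sub>v col A i"
      unfolding mult_mat_vec_add_unit_vec[OF A x i] r_def using A b i by (intro eq_vecI) auto
    then have "norm2_vec r + lam * norm1_vec x \<le> norm2_vec (r - t \<cdot>\<^sub>v col A i)
        + lam * (norm1_vec x + (\<bar>x $ i + t\<bar> - \<bar>x $ i\<bar>))"
      using sqrt_lasso_solutionD(2)[OF sol A z]
      by (simp add: sqrt_lasso_obj_eq[OF A b] x z norm1_vec_add_unit_vec[OF x i]
          flip: r_def)
    with norm2_vec_diff_smult_le[OF r a, of t] pos show ?thesis
      by (simp add: c algebra_simps flip: r_def)
  qed
  from smult_le_power2_imp_abs_subgradient[OF le lam]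
  show "\<bar>col A i \<bullet> y\<bar> \<le> lam" and "(col A i \<bullet> y) * x $ i = lam * \<bar>x $ i\<bar>" .
qed

section \<open>The dual certificate\<close>

lemma scalar_prod_mult_mat_vec_sum:
  fixes A :: "real mat"
  assumes A: "A \<in> carrier_mat m n" and y: "y \<in> carrier_vec m" and z: "z \<in> carrier_vec n"
  shows "y \<bullet> (A *\<^sub>v z) = (\<Sum>i<n. (col A i \<bullet> y) * z $ i)"
proof -
  have "y \<bullet> (A *\<^sub>v z) = (transpose_mat A *\<^sub>v y) \<bullet> z"
    using transpose_vec_mult_scalar[OF A z y] by simp
  also have "\<dots> = (\<Sum>i<n. (col A i \<bullet> y) * z $ i)"
    using A z by (auto simp: scalar_prod_def[of _ z] atLeast0LessThan intro!: sum.cong)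
  finally show ?thesis .
qed

text \<open>Pythagoras: the vector on the left is the component of \<open>v\<close> orthogonal to
  the unit vector \<open>y\<close>.\<close>

lemma proj_compl_power2:
  fixes y v :: "real vec"
  assumes "y \<in> carrier_vec m" "v \<in> carrier_vec m" "y \<bullet> y = 1"
  shows "(v - (y \<bullet> v) \<cdot>\<^sub>v y) \<bullet> (v - (y \<bullet> v) \<cdot>\<^sub>v y) = (norm2_vec v)\<^sup>2 - (y \<bullet> v)\<^sup>2"
  unfolding norm2_vec_power2
  using assms by (simp add: scalar_prod_diff_smult_self[of _ m] power2_eq_square)

text \<open>Cauchy-Schwarz for a unit vector, since the orthogonal component has nonnegative
  square.\<close>

lemma scalar_prod_le_norm2_vec:
  assumes "y \<in> carrier_vec m" "v \<in> carrier_vec m" "y \<bullet> y = 1"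
  shows "y \<bullet> v \<le> norm2_vec v"
  using proj_compl_power2[OF assms] scalar_prod_self_nonneg[of "v - (y \<bullet> v) \<cdot>\<^sub>v y"]
  by (simp add: power2_le_imp_le[OF _ norm2_vec_nonneg])

text \<open>The conditions on \<open>x\<close> say that it attains the lower bound
  \<open>y \<bullet> b\<close>. A solution \<open>z\<close> does no worse, so its nonnegative excess
  terms sum to 0. Thus a \<open>y\<close> obtained from one solution constrains all of them.\<close>

lemma sqrt_lasso_dual_certificate:
  fixes x :: "real vec"
  assumes A: "A \<in> carrier_mat m n" and b: "b \<in> carrier_vec m"
    and y: "y \<in> carrier_vec m" "y \<bullet> y = 1"
    and x: "x \<in> carrier_vec n" "y \<bullet> (b - A *\<^sub>v x) = norm2_vec (b - A *\<^sub>v x)"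
      "\<And>i. i < n \<Longrightarrow> (col A i \<bullet> y) * x $ i = lam * \<bar>x $ i\<bar>"
    and c: "\<And>i. i < n \<Longrightarrow> \<bar>col A i \<bullet> y\<bar> \<le> lam"
    and sol: "is_sqrt_lasso_solution A b lam z"
  shows "y \<bullet> (b - A *\<^sub>v z) = norm2_vec (b - A *\<^sub>v z)"
    and "i < n \<Longrightarrow> (col A i \<bullet> y) * z $ i = lam * \<bar>z $ i\<bar>"
proof -
  note z = sqrt_lasso_solutionD(1)[OF sol A]
  define g where "g i = lam * \<bar>z $ i\<bar> - (col A i \<bullet> y) * z $ i" for i
  define h where "h = norm2_vec (b - A *\<^sub>v z) - y \<bullet> (b - A *\<^sub>v z)"
  have g: "0 \<le> g i" if "i < n" for i
  proof -
    have "(col A i \<bullet> y) * z $ i \<le> \<bar>col A i \<bullet> y\<bar> * \<bar>z $ i\<bar>" by (metis abs_ge_self abs_mult)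
    also have "\<dots> \<le> lam * \<bar>z $ i\<bar>" using c[OF that] by (simp add: mult_right_mono)
    finally show ?thesis by (simp add: g_def)
  qed
  have h: "0 \<le> h" unfolding h_def
    using scalar_prod_le_norm2_vec[of y m "b - A *\<^sub>v z"] y A b z by simp
  \<comment> \<open>Add and subtract \<open>y \<bullet> (b - A *\<^sub>v w)\<close> and expand
    \<open>y \<bullet> (A *\<^sub>v w)\<close> over the columns of \<open>A\<close>.\<close>
  have obj: "sqrt_lasso_obj A b lam w = y \<bullet> b + (norm2_vec (b - A *\<^sub>v w) - y \<bullet> (b - A *\<^sub>v w))
      + (\<Sum>i<n. lam * \<bar>w $ i\<bar> - (col A i \<bullet> y) * w $ i)" if w: "w \<in> carrier_vec n" for w
  proof -
    have "y \<bullet> (b - A *\<^sub>v w) = y \<bullet> b - y \<bullet> (A *\<^sub>v w)"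
      using A b y w by (intro scalar_prod_minus_distrib[of _ m]) auto
    then show ?thesis
      using w by (simp add: sqrt_lasso_obj_eq[OF A b w] scalar_prod_mult_mat_vec_sum[OF A y(1) w]
          norm1_vec_def sum_subtractf sum_distrib_left)
  qed
  have "h + sum g {..<n} \<le> 0"
    using sqrt_lasso_solutionD(2)[OF sol A x(1)] obj[OF z] obj[OF x(1)] x(2,3)
    by (simp add: g_def h_def)
  moreover have "0 \<le> sum g {..<n}" using g by (intro sum_nonneg) auto
  ultimately have "h = 0" and sum0: "sum g {..<n} = 0" using h by linarith+
  then show "y \<bullet> (b - A *\<^sub>v z) = norm2_vec (b - A *\<^sub>v z)" by (simp add: h_def)
  from sum0 have "\<forall>i\<in>{..<n}. g i = 0" using g by (subst (asm) sum_nonneg_eq_0_iff) auto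
  then show "i < n \<Longrightarrow> (col A i \<bullet> y) * z $ i = lam * \<bar>z $ i\<bar>" by (simp add: g_def)
qed

section \<open>The projection, column submatrices and invertibility\<close>

lemma outer_square_mult_vec:
  fixes y :: "real vec"
  assumes "y \<in> carrier_vec m" "v \<in> carrier_vec m"
  shows "outer_square y *\<^sub>v v = (y \<bullet> v) \<cdot>\<^sub>v y"
  using assms
  by (intro eq_vecI)
    (auto simp: outer_square_def mat_of_row_def scalar_prod_def sum_distrib_left mult_ac
      intro!: sum.cong)

lemma cols_submat_carrier:
  assumes "A \<in> carrier_mat m n" "K \<subseteq> {..<n}"
  shows "cols_submat A K \<in> carrier_mat m (card K)"
proof -
  have K: "{j. j < n \<and> j \<in> K} = K" using assms(2) by auto
  have "dim_row A = m" "dim_col A = n" using assms(1) by auto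
  then show ?thesis
    by (intro carrier_matI) (simp_all add: cols_submat_def dim_submatrix K)
qed

text \<open>\<open>pick K\<close> enumerates \<open>K\<close> in increasing order and so inverts the
  position \<open>card {k \<in> K. k < i}\<close>: restricting to \<open>K\<close> loses nothing
  when the support lies in \<open>K\<close>.\<close>

lemma zero_extend_pick:
  assumes "x \<in> carrier_vec n" "\<And>i. i < n \<Longrightarrow> i \<notin> K \<Longrightarrow> x $ i = 0" "K \<subseteq> {..<n}"
  shows "zero_extend n K (vec (card K) (\<lambda>j. x $ pick K j)) = x"
proof -
  have "card {k \<in> K. k < i} < card K" if "i \<in> K" for i
    using that finite_subset[OF assms(3)] by (intro psubset_card_mono) auto
  then show ?thesis
    using assms by (intro eq_vecI) (auto simp: zero_extend_def pick_card_in_set)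
qed

lemma cols_submat_mult_zero_extend:
  fixes A :: "real mat"
  assumes A: "A \<in> carrier_mat m n" and K: "K \<subseteq> {..<n}" and w: "w \<in> carrier_vec (card K)"
  shows "cols_submat A K *\<^sub>v w = A *\<^sub>v zero_extend n K w"
proof (intro eq_vecI)
  have fin: "finite K" using K finite_subset by blast
  show "dim_vec (cols_submat A K *\<^sub>v w) = dim_vec (A *\<^sub>v zero_extend n K w)"
    using A cols_submat_carrier[OF A K] by simp
  fix l assume "l < dim_vec (A *\<^sub>v zero_extend n K w)"
  then have l: "l < m" using A by simp
  have ent: "cols_submat A K $$ (l, card {a \<in> K. a < j}) = A $$ (l, j)" if "j \<in> K" for j
    using submatrix_index_card[of l A j UNIV K] that A K l
    by (auto simp: cols_submat_def)
  \<comment> \<open>The position within \<open>K\<close> matches the columns of \<open>A\<close> in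
    \<open>K\<close> with those of the submatrix; it reindexes the row sum below.\<close>
  have bij: "bij_betw (\<lambda>j. card {a \<in> K. a < j}) K {..<card K}"
  proof (rule bij_betw_byWitness[where f' = "pick K"])
    show "\<forall>j\<in>K. pick K (card {a \<in> K. a < j}) = j" by (simp add: pick_card_in_set)
    show "\<forall>j\<in>{..<card K}. card {a \<in> K. a < pick K j} = j" by (simp add: card_pick_le)
    show "(\<lambda>j. card {a \<in> K. a < j}) ` K \<subseteq> {..<card K}"
      using fin by (auto intro!: psubset_card_mono)
    show "pick K ` {..<card K} \<subseteq> K" by (auto intro: pick_in_set_le)
  qed
  have "(cols_submat A K *\<^sub>v w) $ l = (\<Sum>j<card K. cols_submat A K $$ (l, j) * w $ j)"
    using cols_submat_carrier[OF A K] w l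
    by (auto simp: scalar_prod_def atLeast0LessThan)
  also have "\<dots> = (\<Sum>j\<in>K. A $$ (l, j) * w $ card {a \<in> K. a < j})"
    by (subst sum.reindex_bij_betw[OF bij, symmetric]) (simp add: ent)
  also have "\<dots> = (\<Sum>j<n. A $$ (l, j) * zero_extend n K w $ j)"
    using K by (intro sum.mono_neutral_cong_left) (auto simp: zero_extend_def)
  also have "\<dots> = (A *\<^sub>v zero_extend n K w) $ l"
    using A l by (auto simp: scalar_prod_def zero_extend_def atLeast0LessThan)
  finally show "(cols_submat A K *\<^sub>v w) $ l = (A *\<^sub>v zero_extend n K w) $ l" .
qed

lemma trivial_kernel_imp_inverse:
  fixes M :: "'a :: field mat"
  assumes M: "M \<in> carrier_mat k k"
    and inj: "\<And>w. w \<in> carrier_vec k \<Longrightarrow> M *\<^sub>v w = 0\<^sub>v k \<Longrightarrow> w = 0\<^sub>v k"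
  obtains B where "B \<in> carrier_mat k k" "M * B = 1\<^sub>m k" "B * M = 1\<^sub>m k"
proof -
  have "det M \<noteq> 0" using inj det_0_iff_vec_prod_zero_field[OF M] by auto
  from det_non_zero_imp_unit[OF M this] show ?thesis
    using that by (auto simp: Units_def ring_mat_def)
qed

section \<open>Linear system for the solutions, its invertibility, and uniqueness\<close>

theorem proposition3p8:
  fixes m n :: nat
    and A AJ P M :: "real mat"
    and b xbar ybar :: "real vec"
    and lam :: real
    and J :: "nat set"
  assumes "A \<in> carrier_mat m n"
    and "b \<in> carrier_vec m"
    and "lam > 0"
    and "is_sqrt_lasso_solution A b lam xbar"
    and "A *\<^sub>v xbar \<noteq> b"
    and "ybar = (1 / norm2_vec (A *\<^sub>v xbar - b)) \<cdot>\<^sub>v (b - A *\<^sub>v xbar)"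
    and "J = {i. i < n \<and> \<bar>scalar_prod (col A i) ybar\<bar> = lam}"
    and "AJ = cols_submat A J"
    and "mat_kernel AJ = {0\<^sub>v (card J)}"
    and "b \<notin> mat_range AJ"
    and "P = 1\<^sub>m m - outer_square ybar"
    and "M = transpose_mat AJ * P * AJ"
  shows "(\<forall>z. is_sqrt_lasso_solution A b lam z \<longrightarrow> z = xbar) \<and>
    (\<exists>B \<in> carrier_mat (card J) (card J).
       inverts_mat M B \<and> inverts_mat B M \<and>
       xbar = zero_extend n J ((B * transpose_mat AJ * P) *\<^sub>v b))"
proof -
  note A = assms(1) and b = assms(2) and lam = assms(3) and sol = assms(4)
  define r where "r = b - A *\<^sub>v xbar"
  define R where "R = norm2_vec r"
  define k where "k = card J"
  note x = sqrt_lasso_solutionD(1)[OF sol A]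
  have r: "r \<in> carrier_vec m" using A b x by (simp add: r_def)
  have bx: "b = A *\<^sub>v xbar + r" unfolding r_def using A b x by (intro eq_vecI) auto
  have "r \<noteq> 0\<^sub>v m" using bx assms(5) A x by auto
  then have "R \<noteq> 0"
    using norm2_vec_power2[of r] scalar_prod_self_eq_0_iff[OF r] by (auto simp: R_def)
  then have R: "R > 0" using norm2_vec_nonneg[of r] by (simp add: R_def)
  have y_r: "ybar = (1 / R) \<cdot>\<^sub>v r"
    using assms(6) norm2_vec_minus_commute[of "A *\<^sub>v xbar" m b] A x b
    by (simp add: r_def R_def)
  have y: "ybar \<in> carrier_vec m" using y_r r by simp
  have r_y: "r = R \<cdot>\<^sub>v ybar" unfolding y_r using R by (intro eq_vecI) auto
  have "r \<bullet> r = R * R" using norm2_vec_power2[of r] by (simp add: R_def power2_eq_square)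
  then have yy: "ybar \<bullet> ybar = 1" and yr: "ybar \<bullet> r = R" using R r by (simp_all add: y_r)
  note opt = sqrt_lasso_optimality[OF A b lam sol, folded r_def R_def, OF R y_r]
  have J: "J \<subseteq> {..<n}" using assms(7) by auto
  have AJ: "AJ \<in> carrier_mat m k"
    unfolding assms(8) k_def by (rule cols_submat_carrier[OF A J])
  have O: "outer_square ybar \<in> carrier_mat m m"
    using y by (auto simp: outer_square_def mat_of_row_def)
  have P: "P \<in> carrier_mat m m" unfolding assms(11) using O by (rule minus_carrier_mat)
  have Pv: "P *\<^sub>v v = v - (ybar \<bullet> v) \<cdot>\<^sub>v ybar" if "v \<in> carrier_vec m" for v
    unfolding assms(11) using that y O
    by (simp add: minus_mult_distrib_mat_vec[of _ m m] outer_square_mult_vec[of _ m])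
  have AJt: "transpose_mat AJ \<in> carrier_mat k m" using AJ by simp
  have M: "M \<in> carrier_mat k k" unfolding assms(12) using AJ P by simp
  have Mv: "M *\<^sub>v w = transpose_mat AJ *\<^sub>v (P *\<^sub>v (AJ *\<^sub>v w))" if "w \<in> carrier_vec k" for w
  proof -
    have "M *\<^sub>v w = transpose_mat AJ * P *\<^sub>v (AJ *\<^sub>v w)"
      unfolding assms(12) using AJ AJt P that by (intro assoc_mult_mat_vec[of _ k m _ k]) auto
    also have "\<dots> = transpose_mat AJ *\<^sub>v (P *\<^sub>v (AJ *\<^sub>v w))"
      using AJ AJt P that by (intro assoc_mult_mat_vec[of _ k m _ m]) auto
    finally show ?thesis .
  qed
  \<comment> \<open>The restriction of \<open>z\<close> to \<open>J\<close>, in the order that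
    \<open>zero_extend\<close> expects.\<close>
  define xs where "xs z = vec k (\<lambda>j. z $ pick J j)" for z :: "real vec"
  have xs: "xs z \<in> carrier_vec k" for z by (simp add: xs_def)
  \<comment> \<open>Here \<open>z\<close> is any solution, while \<open>ybar\<close>,
    \<open>J\<close> and \<open>P\<close> stay those of \<open>xbar\<close>.\<close>
  have main: "zero_extend n J (xs z) = z \<and> AJ *\<^sub>v xs z = A *\<^sub>v z
      \<and> M *\<^sub>v xs z = transpose_mat AJ *\<^sub>v (P *\<^sub>v b)"
    if sz: "is_sqrt_lasso_solution A b lam z" for z
  proof -
    note z = sqrt_lasso_solutionD(1)[OF sz A]
    note cert = sqrt_lasso_dual_certificate[OF A b y yy x yr[unfolded r_def R_def] _ _ sz]
    have parallel: "ybar \<bullet> (b - A *\<^sub>v z) = norm2_vec (b - A *\<^sub>v z)"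
      by (rule cert(1)) (use opt in auto)
    have compl: "(col A i \<bullet> ybar) * z $ i = lam * \<bar>z $ i\<bar>" if "i < n" for i
      by (rule cert(2)) (use opt that in auto)
    \<comment> \<open>Outside \<open>J\<close> the factor \<open>|col A i \<bullet> ybar|\<close>
      differs from \<open>lam\<close>, so complementarity forces a zero entry.\<close>
    have "z $ i = 0" if "i < n" "i \<notin> J" for i
    proof (rule ccontr)
      assume "z $ i \<noteq> 0"
      have "\<bar>col A i \<bullet> ybar\<bar> * \<bar>z $ i\<bar> = lam * \<bar>z $ i\<bar>"
        using compl[OF \<open>i < n\<close>] lam by (metis abs_mult abs_abs abs_of_pos)
      with \<open>z $ i \<noteq> 0\<close> that assms(7) show False by simp
    qed
    then have ext: "zero_extend n J (xs z) = z"
      unfolding xs_def k_def by (intro zero_extend_pick z J)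
    have AJz: "AJ *\<^sub>v xs z = A *\<^sub>v z"
      unfolding assms(8) using cols_submat_mult_zero_extend[OF A J, of "xs z"] xs ext
      by (simp add: k_def)
    let ?s = "b - A *\<^sub>v z"
    have s: "?s \<in> carrier_vec m" using A b z by simp
    \<comment> \<open>Equality in Cauchy-Schwarz: the residual has no component orthogonal to
      \<open>ybar\<close>.\<close>
    have "(P *\<^sub>v ?s) \<bullet> (P *\<^sub>v ?s) = 0"
      unfolding Pv[OF s] using proj_compl_power2[OF y s yy] parallel by simp
    then have "P *\<^sub>v ?s = 0\<^sub>v m" using scalar_prod_self_eq_0_iff[of "P *\<^sub>v ?s" m] P s by auto
    moreover have "P *\<^sub>v ?s = P *\<^sub>v b - P *\<^sub>v (A *\<^sub>v z)"
      using P A b z by (intro mult_minus_distrib_mat_vec) auto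
    ultimately have "P *\<^sub>v b - P *\<^sub>v (A *\<^sub>v z) = 0\<^sub>v m" by metis
    then have "P *\<^sub>v b = P *\<^sub>v (A *\<^sub>v z)"
      by (rule minus_vec_eq_zeroD[rotated 2]) (use P A b z in auto)
    then show ?thesis using ext AJz Mv[OF xs] by simp
  qed
  have inj: "w = 0\<^sub>v k" if w: "w \<in> carrier_vec k" and Mw: "M *\<^sub>v w = 0\<^sub>v k" for w
  proof -
    let ?v = "AJ *\<^sub>v w"
    define c where "c = ybar \<bullet> ?v"
    have v: "?v \<in> carrier_vec m" using AJ w by simp
    have Pvc: "P *\<^sub>v ?v \<in> carrier_vec m" using P v by simp
    \<comment> \<open>Pairing \<open>M *\<^sub>v w\<close> with \<open>w\<close> gives the squared
      norm of \<open>P *\<^sub>v ?v\<close>, as \<open>P\<close> is an orthogonal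
      projection.\<close>
    have "0 = (M *\<^sub>v w) \<bullet> w" using Mw w by simp
    also have "\<dots> = (P *\<^sub>v ?v) \<bullet> ?v"
      unfolding Mv[OF w] by (rule transpose_vec_mult_scalar[OF AJ w Pvc])
    also have "\<dots> = (norm2_vec ?v)\<^sup>2 - c\<^sup>2"
      unfolding Pv[OF v] norm2_vec_power2 using v y
      by (simp add: minus_scalar_prod_distrib[of _ m] c_def power2_eq_square)
    also have "\<dots> = (P *\<^sub>v ?v) \<bullet> (P *\<^sub>v ?v)"
      unfolding Pv[OF v] proj_compl_power2[OF y v yy] c_def ..
    finally have "P *\<^sub>v ?v = 0\<^sub>v m" using scalar_prod_self_eq_0_iff[OF Pvc] by simp
    then have "?v - c \<cdot>\<^sub>v ybar = 0\<^sub>v m" using Pv[OF v] unfolding c_def by metis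
    then have vc: "?v = c \<cdot>\<^sub>v ybar"
      by (rule minus_vec_eq_zeroD[rotated 2]) (use v y in auto)
    have "c = 0"
    proof (rule ccontr)
      assume "c \<noteq> 0"
      \<comment> \<open>Both \<open>r\<close> and \<open>A *\<^sub>v xbar\<close> now lie in the
        range of \<open>AJ\<close>, hence so does their sum \<open>b\<close>.\<close>
      then have "r = (R / c) \<cdot>\<^sub>v ?v" unfolding vc r_y by (simp add: smult_smult_assoc)
      also have "\<dots> = AJ *\<^sub>v ((R / c) \<cdot>\<^sub>v w)" using mult_mat_vec[OF AJ w] by simp
      finally have "b = AJ *\<^sub>v (xs xbar + (R / c) \<cdot>\<^sub>v w)"
        using bx main[OF sol] w xs mult_add_distrib_mat_vec[OF AJ, of "xs xbar" "(R / c) \<cdot>\<^sub>v w"]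
        by simp
      moreover have "xs xbar + (R / c) \<cdot>\<^sub>v w \<in> carrier_vec (dim_col AJ)" using AJ w xs by simp
      ultimately show False using assms(10) unfolding mat_range_def by blast
    qed
    then have "?v = 0\<^sub>v m" using vc y by auto
    then have "w \<in> mat_kernel AJ" using mat_kernelI[OF AJ w] by simp
    then show ?thesis using assms(9) by (simp add: k_def)
  qed
  obtain B where B: "B \<in> carrier_mat k k" "M * B = 1\<^sub>m k" "B * M = 1\<^sub>m k"
    using trivial_kernel_imp_inverse[OF M inj] by blast
  \<comment> \<open>The right-hand side does not depend on \<open>z\<close>, so this gives
    uniqueness as well as the formula for \<open>xbar\<close>.\<close>
  have formula: "z = zero_extend n J ((B * transpose_mat AJ * P) *\<^sub>v b)"
    if "is_sqrt_lasso_solution A b lam z" for z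
  proof -
    have "xs z = B *\<^sub>v (M *\<^sub>v xs z)"
      using assoc_mult_mat_vec[OF B(1) M xs, of z] xs[of z] B(3) by simp
    also have "\<dots> = B *\<^sub>v (transpose_mat AJ *\<^sub>v (P *\<^sub>v b))" using main[OF that] by simp
    also have "\<dots> = (B * transpose_mat AJ) *\<^sub>v (P *\<^sub>v b)"
      by (rule assoc_mult_mat_vec[symmetric]) (use B(1) AJt P b in auto)
    also have "\<dots> = (B * transpose_mat AJ * P) *\<^sub>v b"
      by (rule assoc_mult_mat_vec[symmetric]) (use B(1) AJt P b in auto)
    finally show ?thesis using main[OF that] by simp
  qed
  show ?thesis
  proof (intro conjI allI impI bexI[of _ B])
    show "z = xbar" if "is_sqrt_lasso_solution A b lam z" for z
      by (rule trans[OF formula[OF that] formula[OF sol, symmetric]])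
    show "inverts_mat M B" "inverts_mat B M" "B \<in> carrier_mat (card J) (card J)"
      using B M by (simp_all add: inverts_mat_def k_def)
    show "xbar = zero_extend n J ((B * transpose_mat AJ * P) *\<^sub>v b)"
      by (rule formula[OF sol])
  qed
qed

end
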